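(* For every integer $n \geqslant 48$, put $$y_1=\binom{\lceil n/3 \rceil + 1}{2} - 2\left(\left\lfloor \tfrac{2n}{3}\right\rfloor - 1\right),\qquad y_2=\binom{\lfloor (2n+1)/3 \rfloor}{2}.$$ Then every integer in the segment $[y_1,y_2]$ and every integer in the segment $[-y_2,-y_1]$ is an eigenvalue of (the adjacency matrix of) the Transposition graph $T_n$.
   Context: The Transposition graph $T_n$ is the Cayley graph of the symmetric group $\mathrm{Sym}_n$ with respect to the set of all transpositions: its vertices are the elements of $\mathrm{Sym}_n$, and $g,h$ are adjacent iff $g^{-1}h$ is a transposition. The spectrum of a graph is the multiset of eigenvalues of its adjacency matrix. Here $\binom{m}{2}=m(m-1)/2$. *)

theory Defs
  imports
    Complex_Main
    "HOL-Algebra.Sym_Groups"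
    "Graph_Theory.Pair_Digraph"
    "Jordan_Normal_Form.Char_Poly"
begin

definition cayley_graph :: "('a, 'b) monoid_scheme \<Rightarrow> 'a set \<Rightarrow> 'a pair_pre_digraph" where
  "cayley_graph G S =
    \<lparr> pverts = carrier G,
      parcs = {(g, h). g \<in> carrier G \<and> h \<in> carrier G \<and> inv\<^bsub>G\<^esub> g \<otimes>\<^bsub>G\<^esub> h \<in> S} \<rparr>"

definition transpositions :: "nat \<Rightarrow> (nat \<Rightarrow> nat) set" where
  "transpositions n = {transpose a b | a b. a \<in> {1..n} \<and> b \<in> {1..n} \<and> a \<noteq> b}"

definition transposition_graph :: "nat \<Rightarrow> (nat \<Rightarrow> nat) pair_pre_digraph" where
  "transposition_graph n = cayley_graph (sym_group n) (transpositions n)"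

text \<open>
  Matrices are indexed by initial segments of the naturals, so the adjacency matrix is taken
  relative to a listing \<open>vs\<close> of the vertices, meant to be without repetitions. Another such
  listing gives a matrix that is conjugate by a permutation matrix.
\<close>

definition adjacency_matrix :: "'a pair_pre_digraph \<Rightarrow> 'a list \<Rightarrow> real mat" where
  "adjacency_matrix G vs =
    mat (length vs) (length vs) (\<lambda>(i, j). if (vs ! i, vs ! j) \<in> parcs G then 1 else 0)"

lemma transpose_in_sym_group:
  assumes "t \<in> transpositions n"
  shows "t \<in> carrier (sym_group n)"
  using assms by (auto simp: transpositions_def sym_group_carrier intro!: permutes_swap_id)

lemma inv_transposition:
  assumes "t \<in> transpositions n"
  shows "inv\<^bsub>sym_group n\<^esub> t = t"
proof -
  interpret group "sym_group n" by (rule sym_group_is_group)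
  have "t \<otimes>\<^bsub>sym_group n\<^esub> t = \<one>\<^bsub>sym_group n\<^esub>"
    using assms by (auto simp: transpositions_def sym_group_mult sym_group_one)
  then show ?thesis
    using inv_equality transpose_in_sym_group[OF assms] by blast
qed

text \<open>The Transposition graph is a finite simple (that is, loop-free and symmetric) graph.\<close>

lemma pair_graph_transposition_graph: "pair_graph (transposition_graph n)"
proof -
  interpret group "sym_group n" by (rule sym_group_is_group)
  have fin: "finite (carrier (sym_group n))"
    by (simp add: sym_group_def finite_permutations)
  have "finite (parcs (transposition_graph n))"
    by (rule finite_subset[of _ "carrier (sym_group n) \<times> carrier (sym_group n)"])
       (auto simp: transposition_graph_def cayley_graph_def fin)
  moreover have "u \<noteq> v" if "(u, v) \<in> parcs (transposition_graph n)" for u v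
  proof
    assume "u = v"
    with that have "v \<in> carrier (sym_group n)"
      and "inv\<^bsub>sym_group n\<^esub> v \<otimes>\<^bsub>sym_group n\<^esub> v \<in> transpositions n"
      unfolding transposition_graph_def cayley_graph_def by fastforce+
    then have "\<one>\<^bsub>sym_group n\<^esub> \<in> transpositions n"
      using l_inv by metis
    then obtain a b :: nat where "id = transpose a b" "a \<noteq> b"
      by (auto simp: transpositions_def sym_group_one)
    then show False
      by (metis id_apply transpose_apply_first)
  qed
  moreover have "(v, u) \<in> parcs (transposition_graph n)"
    if "(u, v) \<in> parcs (transposition_graph n)" for u v
  proof -
    have uv: "u \<in> carrier (sym_group n)" "v \<in> carrier (sym_group n)"
      and t: "inv\<^bsub>sym_group n\<^esub> u \<otimes>\<^bsub>sym_group n\<^esub> v \<in> transpositions n"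
      using that by (auto simp: transposition_graph_def cayley_graph_def)
    have "inv\<^bsub>sym_group n\<^esub> v \<otimes>\<^bsub>sym_group n\<^esub> u
        = inv\<^bsub>sym_group n\<^esub> (inv\<^bsub>sym_group n\<^esub> u \<otimes>\<^bsub>sym_group n\<^esub> v)"
      using uv by (simp add: inv_mult_group del: sym_group_inv_equality)
    then show ?thesis
      using uv t inv_transposition[OF t]
      by (simp add: transposition_graph_def cayley_graph_def del: sym_group_inv_equality)
  qed
  ultimately show ?thesis
    by unfold_locales
       (auto simp: transposition_graph_def cayley_graph_def fin symmetric_def intro!: symI)
qed

lemma ex_vertex_listing: "\<exists>vs. distinct vs \<and> set vs = pverts (transposition_graph n)"
proof -
  have "finite (pverts (transposition_graph n))"
    by (simp add: transposition_graph_def cayley_graph_def sym_group_def finite_permutations)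
  then show ?thesis
    using finite_distinct_list by blast
qed

end

theory Submission
  imports Defs
begin

text \<open>
  For a Young diagram with rows and columns labelled by a tableau, the element
  \<open>\<Sum> sign c \<cdot> r c\<close> of the group algebra, with \<open>r\<close> preserving rows and \<open>c\<close> preserving columns,
  is an eigenvector of the sum of all transpositions. This sum is central, so a transposition
  \<open>t\<close> may be placed between \<open>r\<close> and \<open>c\<close>: it is absorbed if it preserves the rows, changes the
  sign if it preserves the columns, and makes the sum vanish otherwise. Hence the sum of the contents
  of every Young diagram with \<open>n\<close> cells is an eigenvalue.

  It remains to realize the integers as contents. Putting a row of length \<open>k\<close> on top of a diagram
  with \<open>s = n - k\<close> cells and content \<open>z\<close> gives content \<open>k (k - 1) / 2 - s + z\<close>, and
  transposing a diagram changes the sign. By strong induction every \<open>x\<close> with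
  \<open>\<bar>x\<bar> \<le> b (b - 1) / 2\<close>, \<open>b = \<lfloor>(2 n + 1) / 3\<rfloor>\<close>, is the content of a diagram in
  the \<open>b \<times> b\<close> square, for all \<open>n \<ge> 48\<close>: the intervals obtained for \<open>2 n / 5 \<le> k \<le> b\<close> overlap.
  The start of the induction is a computation based on weaker intervals for some \<open>n < 48\<close>.
\<close>

section \<open>Eigenvectors from tableaux\<close>

text \<open>With the row or the column of an entry as \<open>key\<close>, this is the row group or
  the column group of a tableau.\<close>

definition stab :: "nat \<Rightarrow> (nat \<Rightarrow> nat) \<Rightarrow> (nat \<Rightarrow> nat) set" where
  "stab n key = {p. p permutes {1..n} \<and> (\<forall>x. key (p x) = key x)}"

lemma finite_stab: "finite (stab n key)"
  by (rule finite_subset[OF _ finite_permutations[of "{1..n}"]]) (auto simp: stab_def)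

lemma id_in_stab: "id \<in> stab n key"
  by (simp add: stab_def permutes_id)

lemma comp_in_stab: "p \<in> stab n key \<Longrightarrow> q \<in> stab n key \<Longrightarrow> p \<circ> q \<in> stab n key"
  by (simp add: stab_def permutes_compose)

lemma stab_permutation: "p \<in> stab n key \<Longrightarrow> permutation p"
  unfolding stab_def using permutes_imp_permutation[of "{1..n}"] by blast

lemma transpose_in_stab_iff:
  assumes "a \<in> {1..n}" "b \<in> {1..n}"
  shows "transpose a b \<in> stab n key \<longleftrightarrow> key a = key b"
proof
  assume "transpose a b \<in> stab n key"
  then have "key (transpose a b a) = key a"
    unfolding stab_def by blast
  then show "key a = key b" by simp
next
  assume "key a = key b"
  then show "transpose a b \<in> stab n key"
    using permutes_swap_id[OF assms] by (simp add: stab_def transpose_def)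
qed

lemma finite_transpositions: "finite (transpositions n)"
proof -
  have "transpositions n \<subseteq> (\<lambda>(a, b). transpose a b) ` ({1..n} \<times> {1..n})"
    by (auto simp: transpositions_def)
  then show ?thesis
    by (rule finite_subset) simp
qed

lemma transpose_eq_transposeD:
  assumes "transpose a b = transpose c d" "a \<noteq> b"
  shows "(a = c \<and> b = d) \<or> (a = d \<and> b = c)"
proof -
  have "transpose c d a = b" "transpose c d b = a"
    unfolding assms(1)[symmetric] by simp_all
  then show ?thesis
    using assms(2) by (auto simp: transpose_def split: if_splits)
qed

lemma conjugate_transpose:
  assumes "bij c"
  shows "c \<circ> transpose a b \<circ> inv' c = transpose (c a) (c b)"
proof
  fix x
  obtain y where "x = c y"
    using assms by (metis bij_pointE)
  then show "(c \<circ> transpose a b \<circ> inv' c) x = transpose (c a) (c b) x"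
    using bij_is_inj[OF assms] by (auto simp: transpose_def inj_eq)
qed

lemma conjugate_transposition:
  assumes "t \<in> transpositions n" "c permutes {1..n}"
  shows "c \<circ> t \<circ> inv' c \<in> transpositions n"
proof -
  obtain a b where ab: "t = transpose a b" "a \<in> {1..n}" "b \<in> {1..n}" "a \<noteq> b"
    using assms(1) unfolding transpositions_def by blast
  have "c a \<in> {1..n}" "c b \<in> {1..n}" "c a \<noteq> c b"
    using ab assms(2) permutes_in_image[OF assms(2)] permutes_inj[OF assms(2)] by (auto dest: injD)
  then show ?thesis
    unfolding ab(1) conjugate_transpose[OF permutes_bij[OF assms(2)]] transpositions_def by blast
qed

lemma transposition_comp_self: "t \<in> transpositions n \<Longrightarrow> t \<circ> t = id"
  by (auto simp: transpositions_def)

text \<open>Each transposition is counted at its entry with the larger \<open>pos\<close>; by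
  \<open>init\<close> an entry \<open>b\<close> has exactly \<open>pos b\<close> partners of smaller
  position.\<close>

lemma card_transpositions_stab:
  fixes key pos :: "nat \<Rightarrow> nat"
  assumes inj: "\<And>a b. a \<in> {1..n} \<Longrightarrow> b \<in> {1..n} \<Longrightarrow> key a = key b \<Longrightarrow> pos a = pos b \<Longrightarrow> a = b"
    and init: "\<And>b j. b \<in> {1..n} \<Longrightarrow> j < pos b \<Longrightarrow> \<exists>a\<in>{1..n}. key a = key b \<and> pos a = j"
  shows "card (transpositions n \<inter> stab n key) = (\<Sum>b\<in>{1..n}. pos b)"
proof -
  define A where "A b = {a \<in> {1..n}. key a = key b \<and> pos a < pos b}" for b
  have "card (A b) = pos b" if b: "b \<in> {1..n}" for b
  proof -
    have "bij_betw pos (A b) {..<pos b}"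
      unfolding bij_betw_def A_def using inj init[OF b] by (fastforce simp: inj_on_def)
    then show ?thesis
      using bij_betw_same_card by fastforce
  qed
  then have "(\<Sum>b\<in>{1..n}. pos b) = card (Sigma {1..n} A)"
    by (simp add: A_def)
  also have "\<dots> = card (transpositions n \<inter> stab n key)"
  proof (rule bij_betw_same_card)
    show "bij_betw (\<lambda>(b, a). transpose a b) (Sigma {1..n} A) (transpositions n \<inter> stab n key)"
      unfolding bij_betw_def
    proof (intro conjI equalityI subsetI)
      show "inj_on (\<lambda>(b, a). transpose a b) (Sigma {1..n} A)"
      proof (rule inj_onI, clarify)
        fix a b c d
        assume *: "a \<in> A b" "c \<in> A d" "transpose a b = transpose c d"
        moreover from * have "a \<noteq> b"
          by (auto simp: A_def)
        ultimately show "b = d \<and> a = c"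
          using transpose_eq_transposeD[of a b c d] by (auto simp: A_def)
      qed
    next
      fix t assume "t \<in> (\<lambda>(b, a). transpose a b) ` Sigma {1..n} A"
      then obtain a b where "t = transpose a b" "b \<in> {1..n}" "a \<in> A b"
        by auto
      then show "t \<in> transpositions n \<inter> stab n key"
        unfolding A_def using transpose_in_stab_iff[of a n b key] by (auto simp: transpositions_def)
    next
      fix t assume t: "t \<in> transpositions n \<inter> stab n key"
      then obtain a b where ab: "t = transpose a b" "a \<in> {1..n}" "b \<in> {1..n}" "a \<noteq> b"
        unfolding transpositions_def by blast
      then have "key a = key b"
        using t transpose_in_stab_iff[of a n b key] by blast
      moreover have "pos a \<noteq> pos b"
        using inj ab calculation by blast
      ultimately have "(a, b) \<in> Sigma {1..n} A \<or> (b, a) \<in> Sigma {1..n} A"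
        using ab by (auto simp: A_def)
      then show "t \<in> (\<lambda>(b, a). transpose a b) ` Sigma {1..n} A"
        using ab(1) transpose_commute[of a b] by (metis (no_types, lifting) case_prod_conv image_eqI)
    qed
  qed
  finally show ?thesis by simp
qed

section \<open>The signed sum over row and column groups as an eigenvector\<close>

text \<open>A numbering of the cells of a Young diagram, with rows and columns counted from
  0.\<close>

locale tableau =
  fixes n :: nat and row col :: "nat \<Rightarrow> nat"
  assumes cell_inj: "\<And>x y. x \<in> {1..n} \<Longrightarrow> y \<in> {1..n} \<Longrightarrow> row x = row y \<Longrightarrow> col x = col y \<Longrightarrow> x = y"
    and cell_ex: "\<And>x i j. x \<in> {1..n} \<Longrightarrow> i \<le> row x \<Longrightarrow> j \<le> col x \<Longrightarrow> \<exists>z\<in>{1..n}. row z = i \<and> col z = j"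
begin

text \<open>The coefficient at \<open>g\<close> of the group algebra element summing
  \<open>sign c\<close> times \<open>r t c\<close>; for \<open>t = id\<close> this is a Young
  symmetrizer.\<close>

definition twisted :: "(nat \<Rightarrow> nat) \<Rightarrow> (nat \<Rightarrow> nat) \<Rightarrow> real" where
  "twisted t g = (\<Sum>(r, c)\<in>stab n row \<times> stab n col. if r \<circ> t \<circ> c = g then of_int (sign c) else 0)"

text \<open>Substituting \<open>r \<circ> u\<close> for \<open>r\<close> and
  \<open>w \<circ> c\<close> for \<open>c\<close> permutes the summands; as \<open>u\<close> and
  \<open>w\<close> are involutions, the substitution is its own inverse.\<close>

lemma twisted_shift:
  assumes u: "u \<in> stab n row" "u \<circ> u = id" and w: "w \<in> stab n col" "w \<circ> w = id"
  shows "twisted t g = of_int (sign w) * twisted (u \<circ> t \<circ> w) g"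
proof -
  have uu: "r \<circ> u \<circ> u = r" and ww: "w \<circ> (w \<circ> r) = r" for r
    using u(2) w(2) by (metis comp_assoc comp_id id_comp)+
  have "twisted t g = (\<Sum>(r, c)\<in>stab n row \<times> stab n col.
      if r \<circ> (u \<circ> t \<circ> w) \<circ> c = g then of_int (sign (w \<circ> c)) else 0)"
    unfolding twisted_def
    by (rule sum.reindex_bij_witness[of _ "\<lambda>(r, c). (r \<circ> u, w \<circ> c)" "\<lambda>(r, c). (r \<circ> u, w \<circ> c)"])
       (use u(1) w(1) in \<open>auto simp: uu ww comp_in_stab, (metis comp_assoc uu ww)+\<close>)
  also have "\<dots> = (\<Sum>(r, c)\<in>stab n row \<times> stab n col.
      of_int (sign w) * (if r \<circ> (u \<circ> t \<circ> w) \<circ> c = g then of_int (sign c) else 0))"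
    using w(1) by (intro sum.cong) (auto simp: sign_compose stab_permutation)
  finally show ?thesis
    unfolding twisted_def sum_distrib_left by (simp add: case_prod_beta)
qed

lemma not_row_and_col:
  assumes "t \<in> transpositions n" "t \<in> stab n row" "t \<in> stab n col"
  shows False
proof -
  obtain x y where xy: "t = transpose x y" "x \<in> {1..n}" "y \<in> {1..n}" "x \<noteq> y"
    using assms(1) unfolding transpositions_def by blast
  then have "row x = row y" "col x = col y"
    using assms(2,3) by (simp_all add: transpose_in_stab_iff)
  then show False
    using cell_inj xy by blast
qed

text \<open>If \<open>z\<close> lies in the row of \<open>x\<close> and in the column of \<open>y\<close>, then
  \<open>(x z) (x y) = (x y) (z y)\<close> moves a row transposition into a column transposition.\<close>

lemma twisted_eq_0:
  assumes t: "t \<in> transpositions n" "t \<notin> stab n row" "t \<notin> stab n col"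
  shows "twisted t g = 0"
proof -
  obtain x y where xy: "t = transpose x y" "x \<in> {1..n}" "y \<in> {1..n}"
    using t(1) unfolding transpositions_def by blast
  then have "row x \<noteq> row y" "col x \<noteq> col y"
    using t(2,3) by (simp_all add: transpose_in_stab_iff)
  \<comment> \<open>With \<open>x\<close> in the upper row, the cell in the row of \<open>x\<close>
    and the column of \<open>y\<close> lies above \<open>y\<close>, hence in the diagram.\<close>
  have "\<exists>x y. t = transpose x y \<and> x \<in> {1..n} \<and> y \<in> {1..n} \<and> row x < row y \<and> col x \<noteq> col y"
    using xy \<open>row x \<noteq> row y\<close> \<open>col x \<noteq> col y\<close> transpose_commute[of x y] by (metis linorder_neqE_nat)
  then obtain x y where xy: "t = transpose x y" "x \<in> {1..n}" "y \<in> {1..n}" "row x < row y" "col x \<noteq> col y"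
    by blast
  then obtain z where z: "z \<in> {1..n}" "row z = row x" "col z = col y"
    using cell_ex[of y "row x" "col y"] by auto
  have ne: "z \<noteq> x" "z \<noteq> y" "x \<noteq> y"
    using xy z by auto
  define p q where "p = transpose x z" and "q = transpose z y"
  have "p \<in> stab n row" "q \<in> stab n col"
    using transpose_in_stab_iff z xy unfolding p_def q_def by simp_all
  moreover have "p \<circ> t \<circ> q = t"
    using ne unfolding p_def q_def xy(1) by (auto simp: fun_eq_iff transpose_def)
  moreover have "sign q = - 1"
    using ne unfolding q_def by (simp add: sign_swap_id)
  ultimately have "twisted t g = - twisted t g"
    using twisted_shift[of p q t g] by (simp add: p_def q_def)
  then show ?thesis by simp
qed

text \<open>Taking \<open>u = t\<close> or \<open>w = t\<close> in \<open>twisted_shift\<close>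
  turns the middle factor into \<open>id\<close>; a column transposition costs the sign -1.\<close>

lemma sum_twisted:
  "(\<Sum>t\<in>transpositions n. twisted t g) =
    (real (card (transpositions n \<inter> stab n row)) - real (card (transpositions n \<inter> stab n col))) * twisted id g"
proof -
  have "twisted t g = (of_bool (t \<in> stab n row) - of_bool (t \<in> stab n col)) * twisted id g"
    if t: "t \<in> transpositions n" for t
  proof -
    have tt: "t \<circ> t = id"
      using t by (rule transposition_comp_self)
    consider "t \<in> stab n row" "t \<notin> stab n col" | "t \<notin> stab n row" "t \<in> stab n col"
      | "t \<notin> stab n row" "t \<notin> stab n col"
      using not_row_and_col[OF t] by blast
    then show ?thesis
    proof cases
      case 1
      then show ?thesis
        using twisted_shift[OF _ tt id_in_stab, of t g] tt by simp
    next
      case 2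
      moreover have "sign t = - 1"
        using t by (auto simp: transpositions_def sign_swap_id)
      ultimately show ?thesis
        using twisted_shift[OF id_in_stab _ _ tt, of t g] tt by simp
    next
      case 3
      then show ?thesis
        using twisted_eq_0[OF t] by simp
    qed
  qed
  then have "(\<Sum>t\<in>transpositions n. twisted t g) =
      (\<Sum>t\<in>transpositions n. of_bool (t \<in> stab n row) - of_bool (t \<in> stab n col)) * twisted id g"
    unfolding sum_distrib_right by (rule sum.cong[OF refl])
  then show ?thesis
    by (simp add: sum_subtractf finite_transpositions sum_of_bool_eq Int_def)
qed

text \<open>Centrality of the sum of transpositions: conjugation by \<open>c\<close> moves
  \<open>t\<close> from the right end to the place between \<open>r\<close> and
  \<open>c\<close>.\<close>

lemma sum_right_mult:
  "(\<Sum>t\<in>transpositions n. twisted id (g \<circ> t)) = (\<Sum>t\<in>transpositions n. twisted t g)"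
proof -
  have "(\<Sum>t\<in>transpositions n. if r \<circ> c = g \<circ> t then k else 0) =
      (\<Sum>t\<in>transpositions n. if r \<circ> t \<circ> c = g then k else 0)"
    if "c \<in> stab n col" for r c and k :: real
  proof -
    have c: "c permutes {1..n}"
      using that by (simp add: stab_def)
    have ic: "c \<circ> inv' c = id" "inv' c \<circ> c = id"
      using permutes_inv_o[OF c] by auto
    show ?thesis
    proof (rule sum.reindex_bij_witness[of _ "\<lambda>t. inv' c \<circ> t \<circ> c" "\<lambda>t. c \<circ> t \<circ> inv' c"])
      fix t assume t: "t \<in> transpositions n"
      show "inv' c \<circ> (c \<circ> t \<circ> inv' c) \<circ> c = t" "c \<circ> (inv' c \<circ> t \<circ> c) \<circ> inv' c = t"
        by (metis comp_assoc comp_id id_comp ic)+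
      show "c \<circ> t \<circ> inv' c \<in> transpositions n" "inv' c \<circ> t \<circ> c \<in> transpositions n"
        using conjugate_transposition[OF t c] conjugate_transposition[OF t permutes_inv[OF c]]
        by (simp_all add: permutes_inv_inv[OF c])
      have "r \<circ> (c \<circ> t \<circ> inv' c) \<circ> c = r \<circ> c \<circ> t"
        by (metis comp_assoc comp_id ic(2))
      then show "(if r \<circ> (c \<circ> t \<circ> inv' c) \<circ> c = g then k else 0) = (if r \<circ> c = g \<circ> t then k else 0)"
        using transposition_comp_self[OF t] by (metis comp_assoc comp_id)
    qed
  qed
  then have "(\<Sum>p\<in>stab n row \<times> stab n col. \<Sum>t\<in>transpositions n.
        if fst p \<circ> snd p = g \<circ> t then of_int (sign (snd p)) else 0 :: real) =
      (\<Sum>p\<in>stab n row \<times> stab n col. \<Sum>t\<in>transpositions n.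
        if fst p \<circ> t \<circ> snd p = g then of_int (sign (snd p)) else 0)"
    by (intro sum.cong[of "_ \<times> _", OF refl]) (simp add: mem_Times_iff)
  then show ?thesis
    unfolding twisted_def case_prod_beta comp_id
    by (subst (asm) (1 2) sum.swap)
qed

text \<open>The eigenvector is nonzero: row and column groups meet trivially, so only the pair of
  identities contributes.\<close>

lemma twisted_id_id: "twisted id id = 1"
proof -
  have "r = id \<and> c = id" if r: "r \<in> stab n row" and c: "c \<in> stab n col" and rc: "r \<circ> c = id" for r c
  proof -
    have "c x = x" for x
    proof (cases "x \<in> {1..n}")
      case True
      have "c permutes {1..n}"
        using c by (simp add: stab_def)
      then have "c x \<in> {1..n}"
        using True permutes_in_image by metis
      moreover have "row (r (c x)) = row (c x)" "col (c x) = col x"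
        using r c by (simp_all add: stab_def)
      moreover have "r (c x) = x"
        using rc by (metis comp_apply id_apply)
      ultimately show ?thesis
        using cell_inj True by metis
    next
      case False
      then show ?thesis
        using c by (auto simp: stab_def permutes_def)
    qed
    then have "c = id" by auto
    then show ?thesis using rc by auto
  qed
  then have "r \<circ> id \<circ> c = id \<longleftrightarrow> (r, c) = (id, id)" if "r \<in> stab n row" "c \<in> stab n col" for r c
    using that by auto
  then have "twisted id id = (\<Sum>rc\<in>stab n row \<times> stab n col. if rc = (id, id) then 1 else 0)"
    unfolding twisted_def by (intro sum.cong refl) (simp add: case_prod_beta mem_Times_iff prod_eq_iff)
  then show ?thesis
    by (simp add: finite_stab id_in_stab)
qed

text \<open>An entry in column \<open>j\<close> has \<open>j\<close> entries to its left, so the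
  column indices add up to the number of row transpositions; likewise with rows and columns
  exchanged.\<close>

lemma content_eigenvalue:
  "(\<Sum>t\<in>transpositions n. twisted id (g \<circ> t)) = of_int (\<Sum>x\<in>{1..n}. int (col x) - int (row x)) * twisted id g"
proof -
  have rows: "card (transpositions n \<inter> stab n row) = (\<Sum>x\<in>{1..n}. col x)"
  proof (rule card_transpositions_stab)
    show "\<exists>a\<in>{1..n}. row a = row b \<and> col a = j" if "b \<in> {1..n}" "j < col b" for b j
      using cell_ex[OF that(1) order_refl less_imp_le[OF that(2)]] .
  qed (rule cell_inj)
  have cols: "card (transpositions n \<inter> stab n col) = (\<Sum>x\<in>{1..n}. row x)"
  proof (rule card_transpositions_stab)
    show "\<exists>a\<in>{1..n}. col a = col b \<and> row a = j" if "b \<in> {1..n}" "j < row b" for b j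
      using cell_ex[OF that(1) less_imp_le[OF that(2)] order_refl] by blast
  qed (rule cell_inj)
  show ?thesis
    unfolding sum_right_mult sum_twisted rows cols sum_subtractf by simp
qed

end

section \<open>Functions on the group as vectors of the adjacency matrix\<close>

lemma eigenvalue_transposition_graph:
  assumes vs: "distinct vs" "set vs = pverts (transposition_graph n)"
    and f: "\<And>g. g permutes {1..n} \<Longrightarrow> (\<Sum>t\<in>transpositions n. f (g \<circ> t)) = k * f g"
    and nz: "g0 permutes {1..n}" "f g0 \<noteq> 0"
  shows "eigenvalue (adjacency_matrix (transposition_graph n) vs) k"
proof -
  let ?A = "adjacency_matrix (transposition_graph n) vs"
  let ?v = "vec (length vs) (\<lambda>i. f (vs ! i))"
  have set_vs: "set vs = {p. p permutes {1..n}}"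
    unfolding vs(2) by (auto simp: transposition_graph_def cayley_graph_def sym_group_carrier)
  have arc: "(g, h) \<in> parcs (transposition_graph n) \<longleftrightarrow> inv' g \<circ> h \<in> transpositions n"
    if "g permutes {1..n}" "h permutes {1..n}" for g h
    using that by (simp add: transposition_graph_def cayley_graph_def sym_group_carrier sym_group_mult)
  have dim: "dim_row ?A = length vs" "dim_col ?A = length vs"
    by (simp_all add: adjacency_matrix_def)
  have "(?A *\<^sub>v ?v) $ i = k * f (vs ! i)" if i: "i < length vs" for i
  proof -
    define g where "g = vs ! i"
    have g: "g permutes {1..n}"
      using i set_vs nth_mem unfolding g_def by blast
    have ig: "inv' g \<circ> g = id" "g \<circ> inv' g = id"
      using permutes_inv_o[OF g] by auto
    have "(?A *\<^sub>v ?v) $ i =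
        (\<Sum>j = 0..<length vs. if (g, vs ! j) \<in> parcs (transposition_graph n) then f (vs ! j) else 0)"
      using i by (simp add: adjacency_matrix_def scalar_prod_def g_def if_distrib cong: if_cong)
         (auto intro: sum.cong)
    also have "\<dots> = (\<Sum>h\<in>set vs. if (g, h) \<in> parcs (transposition_graph n) then f h else 0)"
      by (rule sum.reindex_bij_betw) (use bij_betw_nth[OF vs(1)] in \<open>auto simp: atLeast0LessThan\<close>)
    also have "\<dots> = (\<Sum>h | h permutes {1..n} \<and> inv' g \<circ> h \<in> transpositions n. f h)"
      unfolding set_vs using arc[OF g]
      by (subst sum.inter_filter[symmetric]) (auto simp: finite_permutations intro!: sum.cong)
    also have "\<dots> = (\<Sum>t\<in>transpositions n. f (g \<circ> t))"
    proof (rule sum.reindex_bij_witness[of _ "\<lambda>t. g \<circ> t" "\<lambda>h. inv' g \<circ> h"])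
      fix t assume t: "t \<in> transpositions n"
      then have "t permutes {1..n}"
        using transpose_in_sym_group sym_group_carrier by blast
      then show "g \<circ> t \<in> {h. h permutes {1..n} \<and> inv' g \<circ> h \<in> transpositions n}"
        using g t permutes_compose by (simp add: comp_assoc[symmetric] ig)
    qed (auto simp: comp_assoc[symmetric] ig)
    also have "\<dots> = k * f g"
      by (rule f[OF g])
    finally show ?thesis
      by (simp add: g_def)
  qed
  then have "?A *\<^sub>v ?v = k \<cdot>\<^sub>v ?v"
    using dim by (intro eq_vecI) auto
  moreover have "?v \<noteq> 0\<^sub>v (dim_row ?A)"
  proof
    assume 0: "?v = 0\<^sub>v (dim_row ?A)"
    obtain i where "i < length vs" "vs ! i = g0"
      using nz(1) set_vs by (metis in_set_conv_nth mem_Collect_eq)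
    then show False
      using nz(2) dim 0 by (metis index_vec index_zero_vec(1))
  qed
  ultimately show ?thesis
    unfolding eigenvalue_def eigenvector_def using dim by (intro exI[of _ ?v]) auto
qed

section \<open>Contents of Young diagrams\<close>

text \<open>As down-sets of cells, diagrams are transposed by swapping coordinates.\<close>

definition young :: "(nat \<times> nat) set \<Rightarrow> bool" where
  "young D \<longleftrightarrow> finite D \<and> (\<forall>i j i' j'. (i, j) \<in> D \<longrightarrow> i' \<le> i \<longrightarrow> j' \<le> j \<longrightarrow> (i', j') \<in> D)"

definition content :: "(nat \<times> nat) set \<Rightarrow> int" where
  "content D = (\<Sum>(i, j)\<in>D. int j - int i)"

text \<open>The enclosing square of side \<open>d\<close> is invariant under transposition and
  controls which rows can be put on top. Integer sizes avoid truncated subtraction.\<close>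

definition realizable :: "int \<Rightarrow> int \<Rightarrow> int \<Rightarrow> bool" where
  "realizable n d x \<longleftrightarrow> (\<exists>D. young D \<and> int (card D) = n \<and>
     (\<forall>(i, j)\<in>D. int i < d \<and> int j < d) \<and> content D = x)"

lemma realizable_zero: "realizable 0 d 0"
  unfolding realizable_def by (rule exI[of _ "{}"]) (simp add: young_def content_def)

lemma realizable_mono: "realizable n d x \<Longrightarrow> d \<le> d' \<Longrightarrow> realizable n d' x"
  unfolding realizable_def by fastforce

lemma realizable_uminus:
  assumes "realizable n d x"
  shows "realizable n d (- x)"
proof -
  obtain D where D: "young D" "int (card D) = n" "\<forall>(i, j)\<in>D. int i < d \<and> int j < d" "content D = x"
    using assms unfolding realizable_def by blast
  let ?D = "prod.swap ` D"
  have inj: "inj_on prod.swap D"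
    by (metis inj_onI swap_swap)
  have "young ?D"
    using D(1) unfolding young_def by (auto simp: pair_in_swap_image)
  moreover have "int (card ?D) = n"
    using D(2) card_image[OF inj] by simp
  moreover have "content ?D = - x"
    unfolding content_def sum.reindex[OF inj] D(4)[symmetric]
    by (simp add: case_prod_beta sum_subtractf)
  ultimately show ?thesis
    using D(3) unfolding realizable_def by (intro exI[of _ ?D]) auto
qed

lemma realizable_abs: "realizable n d \<bar>x\<bar> \<Longrightarrow> realizable n d x"
  using realizable_uminus[of n d "\<bar>x\<bar>"] by (cases "x \<ge> 0") auto

text \<open>Moving the \<open>s\<close> old cells down one row lowers each content by 1;
  \<open>m \<le> k\<close> keeps the shape a diagram and \<open>m + 1 \<le> d\<close> leaves room
  for the new row.\<close>

lemma realizable_add_row: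
  assumes "realizable s m z" "m \<le> k" "k \<le> d" "m + 1 \<le> d" "0 \<le> k" "2 * x = 2 * z + k * (k - 1) - 2 * s"
  shows "realizable (s + k) d x"
proof -
  obtain D where D: "young D" "int (card D) = s" "\<forall>(i, j)\<in>D. int i < m \<and> int j < m" "content D = z"
    using assms(1) unfolding realizable_def by blast
  define row where "row = (\<lambda>j::nat. (0::nat, j)) ` {..<nat k}"
  define shift where "shift = (\<lambda>(i, j::nat). (Suc i, j))"
  let ?D = "row \<union> shift ` D"
  have fin: "finite D" "finite row" "finite (shift ` D)"
    using D(1) by (auto simp: young_def row_def)
  have disj: "row \<inter> shift ` D = {}"
    by (auto simp: row_def shift_def)
  have inj: "inj_on shift D" "inj_on (\<lambda>j::nat. (0::nat, j)) {..<nat k}"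
    by (auto simp: inj_on_def shift_def)
  have "(i', j') \<in> ?D" if ij: "(i, j) \<in> ?D" and le: "i' \<le> i" "j' \<le> j" for i j i' j'
  proof -
    have j: "j < nat k"
      using ij D(3) assms(2) by (fastforce simp: row_def shift_def)
    show ?thesis
    proof (cases i')
      case 0
      then show ?thesis
        using j le by (auto simp: row_def)
    next
      case (Suc i'')
      then obtain i0 where "i = Suc i0" "(i0, j) \<in> D"
        using ij le by (auto simp: row_def shift_def)
      then have "(i'', j') \<in> D"
        using D(1) le Suc unfolding young_def by (metis Suc_le_mono)
      then show ?thesis
        using Suc by (force simp: shift_def)
    qed
  qed
  then have "young ?D"
    using fin unfolding young_def by blast
  moreover have "int (card ?D) = s + k"
    using card_Un_disjoint[OF fin(2,3) disj] card_image[OF inj(1)] card_image[OF inj(2)] D(2) assms(5)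
    by (simp add: row_def)
  moreover have "content ?D = x"
  proof -
    have "2 * (\<Sum>j<N. int j) = int N * (int N - 1)" for N
      by (induction N) (auto simp: algebra_simps)
    from this[of "nat k"] have "2 * content row = k * (k - 1)"
      unfolding content_def row_def sum.reindex[OF inj(2)] using assms(5) by simp
    moreover have "content (shift ` D) = z - s"
      unfolding content_def sum.reindex[OF inj(1)] D(4)[symmetric] D(2)[symmetric]
      by (simp add: shift_def case_prod_beta sum_subtractf sum.distrib)
    moreover have "content ?D = content row + content (shift ` D)"
      unfolding content_def by (rule sum.union_disjoint[OF fin(2,3) disj])
    ultimately show ?thesis
      using assms(6) by simp
  qed
  moreover have "\<forall>(i, j)\<in>?D. int i < d \<and> int j < d"
    using D(3) assms(3,4) by (auto simp: row_def shift_def)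
  ultimately show ?thesis
    unfolding realizable_def by blast
qed

section \<open>Intervals of realizable contents\<close>

text \<open>\<open>box n * (box n - 1)\<close> is twice the \<open>y2\<close> of the
  theorem.\<close>

definition box :: "int \<Rightarrow> int" where
  "box n = (2 * n + 1) div 3"

text \<open>
  Twice the radius of the interval of contents used in the induction. The values below 48 were found
  by experiment; they are not optimal, and \<open>- 1\<close> makes the interval empty.
\<close>

definition range2 :: "int \<Rightarrow> int" where
  "range2 s = (if 48 \<le> s then box s * (box s - 1)
    else if s < 21 then
      if s = 17 then 64 else if s = 19 then 90 else if s = 20 then 20 else - 1
    else if s < 29 then
      if s = 21 then 60 else if s = 23 then 166 else if s = 25 then 186
      else if s = 28 then 276 else - 1
    else if s < 35 then
      if s = 29 then 324 else if s = 31 then 350 else if s = 32 then 368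
      else if s = 33 then 432 else - 1
    else if s < 42 then
      if s = 35 then 466 else if s = 37 then 600 else if s = 39 then 650
      else if s = 41 then 702 else - 1
    else
      if s = 42 then 678 else if s = 43 then 806 else if s = 45 then 870
      else if s = 47 then 930 else - 1)"

definition seeds :: "int list" where
  "seeds = [17, 19, 20, 21, 23, 25, 28, 29, 31, 32, 33, 35, 37, 39, 41, 42, 43, 45, 47]"

lemma range2_non_seed: "s < 48 \<Longrightarrow> s \<notin> set seeds \<Longrightarrow> range2 s = - 1"
  by (simp add: range2_def seeds_def)

definition good :: "int \<Rightarrow> bool" where
  "good n \<longleftrightarrow> (\<forall>x. 2 * \<bar>x\<bar> \<le> range2 n \<longrightarrow> realizable n (box n) x)"

lemma box_le_iff: "box s \<le> m \<longleftrightarrow> 2 * s \<le> 3 * m + 1"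
  unfolding box_def by linarith

lemma le_box_iff: "m \<le> box s \<longleftrightarrow> 3 * m \<le> 2 * s + 1"
  unfolding box_def by linarith

lemma box_bounds: "2 * s - 1 \<le> 3 * box s" "3 * box s \<le> 2 * s + 1"
  unfolding box_def by linarith+

text \<open>The second assumption says \<open>box s \<le> min k (d - 1)\<close>: the square of the
  remainder fits under the new row.\<close>

lemma good_add_row:
  assumes "good s" "2 * s \<le> 3 * min k (d - 1) + 1" "0 \<le> k" "k \<le> d"
    "\<bar>2 * x - k * (k - 1) + 2 * s\<bar> \<le> range2 s"
  shows "realizable (s + k) d x"
proof -
  define z where "z = x - k * (k - 1) div 2 + s"
  have z: "2 * z = 2 * x - k * (k - 1) + 2 * s"
    unfolding z_def by simp
  then have "2 * \<bar>z\<bar> \<le> range2 s"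
    using assms(5) by linarith
  then have "realizable s (box s) z"
    using assms(1) unfolding good_def by blast
  then have "realizable s (min k (d - 1)) z"
    using realizable_mono box_le_iff assms(2) by blast
  then show ?thesis
    using assms(3,4) z by (intro realizable_add_row[of s "min k (d - 1)" z]) auto
qed

section \<open>Executable search for diagrams\<close>

text \<open>
  The argument \<open>X\<close> below is always twice a content, which avoids divisions in the evaluation.
  A descending search over the length \<open>k\<close> of the first row; since diagrams with \<open>s\<close> cells and at
  most \<open>m\<close> columns have content at most \<open>s (m - 1) / 2\<close>, most \<open>k\<close> are discarded at once.
  The conditionals replace conjunctions and disjunctions because only they are evaluated lazily.
\<close>

function search :: "int \<Rightarrow> int \<Rightarrow> int \<Rightarrow> int \<Rightarrow> bool" where
  "search n d k X = (if n \<le> 0 then n = 0 \<and> X = 0 else if k \<le> 0 then False else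
    let s = n - k; m = min k (d - 1); Z = X - k * (k - 1) + 2 * s in
    if s * (m - 1) < \<bar>Z\<bar> then (if 0 < Z then False else search n d (k - 1) X)
    else if (if 2 * s \<le> 3 * m + 1 then \<bar>Z\<bar> \<le> range2 s else False) then True
    else if search s m (min m s) \<bar>Z\<bar> then True
    else search n d (k - 1) X)"
  by pat_completeness auto
termination
  by (relation "measure (\<lambda>(n, d, k, X). nat (n + k))") auto

declare search.simps [simp del]

text \<open>Only the answer \<open>True\<close> is justified, so the pruning calls for no argument.
  Passing to \<open>\<bar>Z\<bar>\<close> is allowed by transposing the remainder.\<close>

lemma search_sound:
  assumes "search n d k X" "k \<le> d" "X = 2 * x" "\<And>s. s < n \<Longrightarrow> good s"
  shows "realizable n d x"
  using assms
proof (induction "nat (n + k)" arbitrary: n d k X x rule: less_induct)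
  case less
  define s m Z where "s = n - k" and "m = min k (d - 1)" and "Z = X - k * (k - 1) + 2 * s"
  have prev: "realizable n d x" if "0 < n" "0 < k" "search n d (k - 1) X"
    using less(1)[of n "k - 1" d X x] less.prems that by simp
  have sub: "realizable n d x" if "0 < n" "0 < k" "search s m (min m s) \<bar>Z\<bar>"
  proof -
    define z where "z = x - k * (k - 1) div 2 + s"
    have z: "Z = 2 * z"
      unfolding z_def Z_def less.prems(3) by simp
    have "realizable s m \<bar>z\<bar>"
      by (rule less(1)[OF _ that(3)]) (use that less.prems in \<open>auto simp: z s_def m_def\<close>)
    then have "realizable s m z"
      by (rule realizable_abs)
    then show ?thesis
      using realizable_add_row[of s m z k d x] that z less.prems(2,3)
      unfolding Z_def s_def m_def by simp
  qed
  have leaf: "realizable n d x" if "0 < k" "2 * s \<le> 3 * m + 1" "\<bar>Z\<bar> \<le> range2 s"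
    using good_add_row[of s k d x] that less.prems unfolding s_def m_def Z_def by simp
  show ?case
    using less.prems(1,3) realizable_zero[of d] prev sub leaf
    unfolding search.simps[of n d k X] s_def[symmetric] m_def[symmetric] Let_def Z_def[symmetric]
    by (auto split: if_splits)
qed

text \<open>
  The right end of an interval around \<open>X\<close> obtained from a single row, or \<open>X - 1\<close> if there is none.
\<close>

function jump :: "int \<Rightarrow> int \<Rightarrow> int \<Rightarrow> int \<Rightarrow> int" where
  "jump n b X k = (if k \<le> 0 then X - 1 else
    let s = n - k; c = k * (k - 1) - 2 * s in
    if (if 2 * s \<le> 3 * min k (b - 1) + 1 then \<bar>X - c\<bar> \<le> range2 s else False) then c + range2 s
    else jump n b X (k - 1))"
  by pat_completeness auto
termination
  by (relation "measure (\<lambda>(n, b, X, k). nat k)") auto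

declare jump.simps [simp del]

text \<open>An interval that contains \<open>X\<close> contains everything from \<open>X\<close> to
  its right end; the default \<open>X - 1\<close> contradicts the first two assumptions.\<close>

lemma jump_sound:
  assumes "X \<le> 2 * x" "2 * x \<le> jump n (box n) X k" "k \<le> box n" "\<And>s. s < n \<Longrightarrow> good s"
  shows "realizable n (box n) x"
  using assms
proof (induction "nat k" arbitrary: k rule: less_induct)
  case less
  define s c where "s = n - k" and "c = k * (k - 1) - 2 * s"
  have prev: "realizable n (box n) x" if "0 < k" "2 * x \<le> jump n (box n) X (k - 1)"
    using less.hyps[of "k - 1"] less.prems that by simp
  have leaf: "realizable n (box n) x"
    if "0 < k" "2 * s \<le> 3 * min k (box n - 1) + 1" "\<bar>X - c\<bar> \<le> range2 s" "2 * x \<le> c + range2 s"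
    using good_add_row[of s k "box n" x] that less.prems unfolding s_def c_def by simp
  show ?case
    using less.prems(1,2) prev leaf
    unfolding jump.simps[of n "box n" X k] s_def[symmetric] Let_def c_def[symmetric]
    by (auto split: if_splits)
qed

text \<open>A sweep over even \<open>X\<close>: \<open>jump\<close> settles whole intervals cheaply,
  and the costlier \<open>search\<close> is kept for single values left in gaps.\<close>

function covered :: "int \<Rightarrow> int \<Rightarrow> int \<Rightarrow> bool" where
  "covered n b X = (if range2 n < X then True else
    let U = jump n b X b in
    if X \<le> U then covered n b (if even U then U + 2 else U + 1)
    else if search n b b X then covered n b (X + 2)
    else False)"
  by pat_completeness auto
termination
  by (relation "measure (\<lambda>(n, b, X). nat (range2 n + 1 - X))") auto

declare covered.simps [simp del]

lemma covered_sound: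
  assumes "covered n (box n) X" "X \<le> 2 * x" "even X" "2 * x \<le> range2 n" "\<And>s. s < n \<Longrightarrow> good s"
  shows "realizable n (box n) x"
  using assms
proof (induction "nat (range2 n + 1 - X)" arbitrary: X rule: less_induct)
  case less
  define U where "U = jump n (box n) X (box n)"
  \<comment> \<open>The sweep continues at \<open>X'\<close>; this round settles the even numbers
    from \<open>X\<close> up to but excluding \<open>X'\<close>.\<close>
  define X' where "X' = (if X \<le> U then if even U then U + 2 else U + 1 else X + 2)"
  have X': "X + 2 \<le> X'" "even X'"
    using less.prems(3) by (auto simp: X'_def elim!: evenE oddE)
  have "X \<le> range2 n"
    using less.prems by simp
  then have step: "covered n (box n) X'" "X \<le> U \<or> search n (box n) (box n) X"
    using less.prems(1) unfolding covered.simps[of n "box n" X] U_def[symmetric] Let_def X'_def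
    by (auto split: if_splits)
  show ?case
  proof (cases "X' \<le> 2 * x")
    case True
    show ?thesis
      by (rule less.hyps[OF _ step(1)]) (use X' True less.prems in auto)
  next
    case False
    show ?thesis
    proof (cases "X \<le> U")
      case True
      then have "2 * x \<le> U"
        using False by (auto simp: X'_def split: if_splits elim!: evenE)
      then show ?thesis
        using jump_sound[OF less.prems(2)] less.prems(5) unfolding U_def by simp
    next
      case 2: False
      then have "X = 2 * x"
        using False less.prems(2,3) by (auto simp: X'_def elim!: evenE)
      then show ?thesis
        using search_sound[of n "box n" "box n" X x] step(2) 2 less.prems(5) by simp
    qed
  qed
qed

lemma good_if_covered:
  assumes "covered n (box n) 0" "\<And>s. s < n \<Longrightarrow> good s"
  shows "good n"
  unfolding good_def
proof (intro allI impI)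
  fix x :: int
  assume "2 * \<bar>x\<bar> \<le> range2 n"
  then have "realizable n (box n) \<bar>x\<bar>"
    using covered_sound[OF assms(1)] assms(2) by simp
  then show "realizable n (box n) x"
    by (rule realizable_abs)
qed

section \<open>Computed base cases and the induction step\<close>

lemma covered_seeds:
  "list_all (\<lambda>n. covered n (box n) 0) seeds"
  by code_simp

lemma covered_48_58: "list_all (\<lambda>n. covered n (box n) 0) [48..58]"
  by code_simp

lemma covered_59_142: "list_all (\<lambda>n. covered n (box n) 0) [59..142]"
  by code_simp

lemma good_if_neg: "s < 0 \<Longrightarrow> good s"
  by (auto simp: good_def range2_def)

text \<open>143 is the least size from which a first row of at most \<open>box n\<close> cells
  always leaves at least 48 cells, so only the full intervals enter.\<close>

lemma good_large:
  assumes "143 \<le> n" "\<And>s. 48 \<le> s \<Longrightarrow> s < n \<Longrightarrow> good s"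
  shows "good n"
  unfolding good_def
proof (intro allI impI)
  fix x :: int
  assume x: "2 * \<bar>x\<bar> \<le> range2 n"
  define X where "X = 2 * \<bar>x\<bar>"
  define Lo Hi where "Lo k = k * (k - 1) - 2 * (n - k) - range2 (n - k)"
    and "Hi k = k * (k - 1) - 2 * (n - k) + range2 (n - k)" for k
  \<comment> \<open>The least \<open>k\<close> with \<open>box (n - k) \<le> k\<close>, that is,
    with \<open>5 * k \<ge> 2 * n - 1\<close>.\<close>
  define k0 where "k0 = (2 * n + 3) div 5"
  have bound: "48 \<le> n - k" if "k \<le> box n" for k
    using assms(1) that unfolding box_def by linarith
  \<comment> \<open>A linear lower bound, from \<open>box s - 1 \<ge> 31\<close> and 31 / 3 > 10,
    suffices for the overlaps.\<close>
  have range2: "range2 s = box s * (box s - 1)" "10 * (2 * s - 1) \<le> range2 s" if "48 \<le> s" for s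
  proof -
    show *: "range2 s = box s * (box s - 1)"
      using that by (simp add: range2_def)
    have "2 * s - 1 \<le> 3 * box s" "31 \<le> box s - 1"
      using that unfolding box_def by linarith+
    then have "10 * (2 * s - 1) \<le> box s * 31"
      by simp
    also have "box s * 31 \<le> box s * (box s - 1)"
      using \<open>31 \<le> box s - 1\<close> by (intro mult_left_mono) auto
    finally show "10 * (2 * s - 1) \<le> range2 s"
      unfolding * .
  qed
  have k0: "5 * k0 \<le> 2 * n + 3" "2 * n - 1 \<le> 5 * k0"
    unfolding k0_def by linarith+
  have k0_le: "k0 \<le> box n"
    unfolding le_box_iff using assms(1) k0 by simp
  \<comment> \<open>By minimality of \<open>k0\<close> the remainder's square has side at least
    \<open>k0 - 1\<close>, so the first interval reaches down to 0.\<close>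
  have Lo0: "Lo k0 \<le> 0"
  proof -
    have "k0 - 1 \<le> box (n - k0)" "box (n - k0) \<le> n - k0"
      unfolding le_box_iff box_le_iff using assms(1) k0 by auto
    then have "k0 * (k0 - 1) \<le> (box (n - k0) + 1) * box (n - k0)"
      using assms(1) k0 by (intro mult_mono) auto
    also have "\<dots> = range2 (n - k0) + 2 * box (n - k0)"
      unfolding range2(1)[OF bound[OF k0_le]] by (simp add: algebra_simps)
    finally show ?thesis
      using \<open>box (n - k0) \<le> n - k0\<close> unfolding Lo_def by simp
  qed
  have Hi1: "X \<le> Hi (box n)"
    using x range2(1)[of n] range2(2)[OF bound[of "box n"]] bound[of "box n"] assms(1)
    unfolding X_def Hi_def by simp
  \<comment> \<open>The centres of neighbouring intervals are only \<open>2 * k + 2\<close> apart,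
    which the two radii exceed.\<close>
  have glue: "Lo (k + 1) \<le> Hi k + 1" if "k0 \<le> k" "k + 1 \<le> box n" for k
  proof -
    have s: "48 \<le> n - k" "48 \<le> n - (k + 1)"
      using that bound[of k] bound[of "k + 1"] by auto
    have "k \<le> 2 * (n - k) + 1"
      using that(2) unfolding le_box_iff by simp
    then show ?thesis
      using range2(2)[OF s(1)] range2(2)[OF s(2)] s unfolding Lo_def Hi_def
      by (simp add: algebra_simps)
  qed
  \<comment> \<open>Descent on the row length: an \<open>X\<close> below the interval of
    \<open>m + 1\<close> is at most \<open>Hi m\<close> by \<open>glue\<close>.\<close>
  have "\<exists>k\<ge>k0. k \<le> m \<and> Lo k \<le> X \<and> X \<le> Hi k" if "k0 \<le> m" "m \<le> box n" "X \<le> Hi m" for m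
    using that
  proof (induction m rule: int_ge_induct)
    case base
    then show ?case
      using Lo0 by (auto simp: X_def)
  next
    case (step m)
    show ?case
    proof (cases "Lo (m + 1) \<le> X")
      case True
      then show ?thesis
        using step by (intro exI[of _ "m + 1"]) auto
    next
      case False
      then have "X \<le> Hi m"
        using glue[of m] step by linarith
      then show ?thesis
        using step by fastforce
    qed
  qed
  moreover have "k0 \<le> box n"
    by (rule k0_le)
  ultimately obtain k where k: "k0 \<le> k" "k \<le> box n" "Lo k \<le> X" "X \<le> Hi k"
    using Hi1 by blast
  have "realizable (n - k + k) (box n) \<bar>x\<bar>"
  proof (rule good_add_row)
    show "good (n - k)"
      using assms bound[OF k(2)] k k0 by auto
    show "2 * (n - k) \<le> 3 * min k (box n - 1) + 1"
      using k(1,2) k0 assms(1) box_bounds[of n] by (auto simp: min_def)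
    show "0 \<le> k"
      using k(1) k0 assms(1) by linarith
    show "k \<le> box n"
      by (rule k(2))
    show "\<bar>2 * \<bar>x\<bar> - k * (k - 1) + 2 * (n - k)\<bar> \<le> range2 (n - k)"
      using k(3,4) unfolding Lo_def Hi_def X_def by linarith
  qed
  then show "realizable n (box n) x"
    using realizable_abs by simp
qed

lemma good: "good n"
proof (induction "nat n" arbitrary: n rule: less_induct)
  case less
  \<comment> \<open>\<open>nat\<close> does not decrease below 0, so negative sizes are treated
    apart.\<close>
  have IH: "good s" if "s < n" for s
    using less[of s] that good_if_neg[of s] by (cases "0 \<le> s") auto
  consider "143 \<le> n" | "48 \<le> n" "n < 143" | "n < 48" by linarith
  then show ?case
  proof cases
    case 1
    then show ?thesis using good_large IH by blast
  next
    case 2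
    then have "n \<in> set [48..58] \<union> set [59..142]"
      unfolding set_upto by auto
    then have "covered n (box n) 0"
      using covered_48_58 covered_59_142 unfolding list_all_iff by blast
    then show ?thesis
      using good_if_covered IH by blast
  next
    case 3
    show ?thesis
    proof (cases "n \<in> set seeds")
      case True
      then have "covered n (box n) 0"
        using covered_seeds unfolding list_all_iff by blast
      then show ?thesis
        using good_if_covered IH by blast
    next
      case False
      then show ?thesis
        using range2_non_seed[OF 3] by (auto simp: good_def)
    qed
  qed
qed

section \<open>From contents to eigenvalues\<close>

text \<open>An arbitrary numbering of the cells of the diagram is a \<open>tableau\<close>, whose
  eigenvalue is the content.\<close>

lemma realizable_eigenvalue:
  assumes "realizable (int n) d x"
    and vs: "distinct vs" "set vs = pverts (transposition_graph n)"
  shows "eigenvalue (adjacency_matrix (transposition_graph n) vs) (real_of_int x)"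
proof -
  obtain D where D: "young D" "card D = n" "content D = x"
    using assms(1) unfolding realizable_def by auto
  obtain e where e: "bij_betw e {1..n} D"
    using finite_same_card_bij[of "{1..n}" D] D(1,2) by (auto simp: young_def)
  interpret tableau n "\<lambda>x. fst (e x)" "\<lambda>x. snd (e x)"
  proof
    fix x y
    assume "x \<in> {1..n}" "y \<in> {1..n}" "fst (e x) = fst (e y)" "snd (e x) = snd (e y)"
    then show "x = y"
      using inj_onD[OF bij_betw_imp_inj_on[OF e]] by (metis prod_eqI)
  next
    fix x i j
    assume x: "x \<in> {1..n}" "i \<le> fst (e x)" "j \<le> snd (e x)"
    then have "(fst (e x), snd (e x)) \<in> D"
      using bij_betwE[OF e] by simp
    then have "(i, j) \<in> D"
      using D(1) x(2,3) unfolding young_def by blast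
    then obtain z where "z \<in> {1..n}" "e z = (i, j)"
      using bij_betw_imp_surj_on[OF e] by (metis imageE)
    then show "\<exists>z\<in>{1..n}. fst (e z) = i \<and> snd (e z) = j"
      by force
  qed
  have "(\<Sum>x\<in>{1..n}. int (snd (e x)) - int (fst (e x))) = x"
    using sum.reindex_bij_betw[OF e, of "\<lambda>(i, j). int j - int i"] D(3)
    by (simp add: content_def case_prod_beta)
  then have "(\<Sum>t\<in>transpositions n. twisted id (g \<circ> t)) = real_of_int x * twisted id g" for g
    using content_eigenvalue[of g] by simp
  then show ?thesis
    using eigenvalue_transposition_graph[OF vs, of "twisted id" "real_of_int x" id] twisted_id_id
    by (simp add: permutes_id)
qed

theorem theorem4:
  fixes n :: nat and y1 y2 :: int and vs :: "(nat \<Rightarrow> nat) list"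
  assumes "n \<ge> 48"
    and "y1 = int ((nat \<lceil>real n / 3\<rceil> + 1) choose 2) - 2 * (\<lfloor>2 * real n / 3\<rfloor> - 1)"
    and "y2 = int (nat \<lfloor>(2 * real n + 1) / 3\<rfloor> choose 2)"
    and "distinct vs" and "set vs = pverts (transposition_graph n)"
  shows "\<forall>x \<in> {y1..y2} \<union> {-y2..-y1}.
    eigenvalue (adjacency_matrix (transposition_graph n) vs) (real_of_int x)"
proof
  fix x
  assume x: "x \<in> {y1..y2} \<union> {- y2..- y1}"
  define b where "b = (2 * n + 1) div 3"
  have "\<lfloor>(2 * real n + 1) / 3\<rfloor> = int b"
    using floor_divide_of_nat_eq[where 'a = real, of "2 * n + 1" 3] by (simp add: b_def add.commute)
  then have "y2 = int (b choose 2)"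
    unfolding assms(3) by simp
  moreover have "even (b * (b - 1))"
    by (cases b) auto
  then have "2 * (b choose 2) = b * (b - 1)"
    unfolding choose_two by (rule dvd_mult_div_cancel)
  then have "2 * int (b choose 2) = int (b * (b - 1))"
    by (metis of_nat_mult of_nat_numeral)
  ultimately have y2: "2 * y2 = int b * (int b - 1)"
    using assms(1) by (simp add: b_def of_nat_diff)
  have "\<lfloor>2 * real n / 3\<rfloor> = int (2 * n div 3)"
    using floor_divide_of_nat_eq[where 'a = real, of "2 * n" 3] by simp
  \<comment> \<open>With \<open>2 * b \<le> y2\<close>, shown next, this gives
    \<open>- y2 \<le> y1\<close>, so both segments lie between \<open>- y2\<close> and
    \<open>y2\<close>.\<close>
  then have "- 2 * int b \<le> y1"
    unfolding assms(2) b_def by simp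
  moreover have "int b * 4 \<le> int b * (int b - 1)"
    using assms(1) unfolding b_def by (intro mult_left_mono) auto
  ultimately have "2 * \<bar>x\<bar> \<le> int b * (int b - 1)"
    using x y2 by auto
  moreover have "box (int n) = int b"
    by (simp add: box_def b_def)
  ultimately have "realizable (int n) (box (int n)) x"
    using good[of "int n"] assms(1) unfolding good_def range2_def by simp
  then show "eigenvalue (adjacency_matrix (transposition_graph n) vs) (real_of_int x)"
    by (rule realizable_eigenvalue[OF _ assms(4,5)])
qed

end
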